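(* Let $H$ be a real Hilbert space and let $J:H\to\mathbb{R}$ be twice continuously Fréchet differentiable with a global minimizer $x^*\in H$. Suppose that for some constant $L>0$ $$\|J''(x)-J''(y)\|_{L(H)}\le L\|x-y\|,\quad x,y\in H.$$ Let $\xi\in H$ and suppose that $w\in H$ satisfies $x^*-\xi=J''(x^* )w$ and $L\|w\|<\frac14$. Fix $0<\theta<1$, $\mu>0$, $\alpha_0>0$, $0<s<1/2$, and choose $q>0$ such that $$\Phi(q)=2q-4\|w\|-\frac{L}{2}(q+2\|w\|)^2>0$$ (this is possible, and it implies $q>2\|w\|$). Then there is $k_0\in\mathbb{N}$, independent of $\delta$ (and of $J_\delta$), such that for every integer $k\ge k_0$ the following holds with $\alpha_n=\alpha_0(n+k)^{-s}$, $n\in\mathbb{N}$. Let $\delta\ge0$ and let $J_\delta:H\to\mathbb{R}$ be a Fréchet differentiable functional with $$\|J_\delta'(x)-J'(x)\|\le\delta(1+\|x-\xi\|),\quad x\in H$$ ($J_\delta=J$ if $\delta=0$). Let $x_1\in H$ satisfy $$\|x_1-x^*\|\le(q-2\|w\|)\alpha_1,$$ and define $$x_{n+1}=x_n-\mu\alpha_n\bigl(J_\delta'(x_n)+2\alpha_n(x_n-\xi)\bigr),\quad n\in\mathbb{N}.$$ (i) If $\delta=0$, then $\|x_n-x^*\|\le(q+2\|w\|)\alpha_n$ for all $n\in\mathbb{N}$. (ii) If $\delta>0$ and the stopping index is $N=\min\{n\ge1\mid\alpha_n\le K_2\sqrt\delta\}$, where $$K_2\ge\sqrt{\frac{C_9}{\theta\Phi(q)}},\quad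 C_9=1+\|J''(x^* )w\|+(q+2\|w\|)\alpha_1,$$ then $\|x_N-x^*\|\le(q+2\|w\|)K_2\sqrt\delta$.
   Context: $\|\cdot\|$ is the norm of $H$ and $\|\cdot\|_{L(H)}$ is the operator norm on bounded linear operators on $H$. First derivatives $J'(x),J_\delta'(x)\in H$ are gradients and $J''(x)\in L(H)$ is the (self-adjoint) second Fréchet derivative, via the Riesz identification. $\mathbb{N}=\{1,2,\dots\}$. *)

theory Defs
  imports "HOL-Analysis.Analysis"
begin

definition Phi :: "real \<Rightarrow> 'a::real_normed_vector \<Rightarrow> real \<Rightarrow> real" where
  "Phi L w q = 2 * q - 4 * norm w - L / 2 * (q + 2 * norm w)\<^sup>2"

text \<open>The regularization parameters \<open>\<alpha>\<^sub>n = \<alpha>\<^sub>0 (n + k)\<^sup>-\<^sup>s\<close>; only indices \<open>n \<ge> 1\<close> are meaningful.\<close>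

definition reg_param :: "real \<Rightarrow> real \<Rightarrow> nat \<Rightarrow> nat \<Rightarrow> real" where
  "reg_param \<alpha>0 s k n = \<alpha>0 * real (n + k) powr (- s)"

text \<open>Indexing starts at \<open>1\<close>, so the value \<open>x 0\<close> is unconstrained. \<open>G\<close> is the gradient
  of the functional used in the iteration.\<close>

definition reg_gradient_iteration ::
    "('a::real_normed_vector \<Rightarrow> 'a) \<Rightarrow> 'a \<Rightarrow> real \<Rightarrow> (nat \<Rightarrow> real) \<Rightarrow> (nat \<Rightarrow> 'a) \<Rightarrow> bool" where
  "reg_gradient_iteration G \<xi> \<mu> \<alpha> x \<longleftrightarrow>
     (\<forall>n\<ge>1. x (Suc n) = x n - (\<mu> * \<alpha> n) *\<^sub>R (G (x n) + (2 * \<alpha> n) *\<^sub>R (x n - \<xi>)))"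

definition C9 :: "('a::real_normed_vector \<Rightarrow>\<^sub>L 'a) \<Rightarrow> 'a \<Rightarrow> real \<Rightarrow> real \<Rightarrow> real" where
  "C9 A w q \<alpha>1 = 1 + norm (blinfun_apply A w) + (q + 2 * norm w) * \<alpha>1"

definition stopping_index :: "(nat \<Rightarrow> real) \<Rightarrow> real \<Rightarrow> real \<Rightarrow> nat" where
  "stopping_index \<alpha> K \<delta> = (LEAST n. 1 \<le> n \<and> \<alpha> n \<le> K * sqrt \<delta>)"

end

(* Put A = J''(xstar), a symmetric positive operator, and let z(a) = xstar - 2a (A + 2a)^(-1) A w be
   the zero of the regularised gradient linearised at xstar. Then |z(a) - xstar| <= 2a |w| and
   |z(a) - z(b)| <= 2 |a - b| |w|. One gradient step contracts the distance to z(alpha_n) by the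
   factor 1 - 2 mu alpha_n^2. Phi(q) > 0 says that this gain exceeds the Taylor remainder by at least
   mu Phi(q) alpha_n^3; before the stopping index a share theta of the surplus absorbs the noise, and,
   as alpha_n - alpha_(n+1) = o(alpha_n^3) for s < 1/2, the rest pays for replacing alpha_n by
   alpha_(n+1). So |x_n - z(alpha_n)| <= q alpha_n is preserved. *)

theory Submission
  imports Defs
begin

section \<open>Positive operators and their shifted inverses\<close>

definition positive_operator :: "('a::real_inner \<Rightarrow>\<^sub>L 'a) \<Rightarrow> bool" where
  "positive_operator A \<longleftrightarrow>
     (\<forall>u v. inner (blinfun_apply A u) v = inner u (blinfun_apply A v)) \<and>
     (\<forall>u. 0 \<le> inner (blinfun_apply A u) u)"

lemma positive_operator_inner_nonneg:
  "positive_operator A \<Longrightarrow> 0 \<le> inner (blinfun_apply A u) u"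
  unfolding positive_operator_def by blast

text \<open>This is \<open>A\<^sup>2 \<le> norm A * A\<close> in the sense of quadratic forms,
  obtained without an operator square root: positivity is tested at
  \<open>norm A *\<^sub>R u - A u\<close>, and \<open>inner (A v) v \<le> norm A * inner v v\<close>
  for \<open>v = A u\<close> absorbs the last term.\<close>

lemma positive_operator_norm_square_le:
  fixes A :: "'a::real_inner \<Rightarrow>\<^sub>L 'a"
  assumes "positive_operator A"
  shows "(norm (A u))\<^sup>2 \<le> norm A * inner (A u) u"
proof (cases "norm A = 0")
  case True
  then show ?thesis by simp
next
  case False
  define a where "a = norm A"
  have a: "a > 0" using False by (simp add: a_def)
  define v where "v = A u"
  have sym: "inner u (A v) = inner v v"
    using assms unfolding positive_operator_def v_def by simp
  have "inner (A v) v \<le> norm (A v) * norm v" by (rule norm_cauchy_schwarz)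
  also have "\<dots> \<le> (a * norm v) * norm v"
    unfolding a_def by (intro mult_right_mono norm_blinfun) simp
  finally have Avv: "inner (A v) v \<le> a * inner v v"
    by (simp add: power2_norm_eq_inner[symmetric] power2_eq_square mult.assoc)
  have "0 \<le> inner (A (a *\<^sub>R u - v)) (a *\<^sub>R u - v)"
    by (rule positive_operator_inner_nonneg[OF assms])
  also have "\<dots> = a * a * inner v u - 2 * a * inner v v + inner (A v) v"
    by (simp add: blinfun.bilinear_simps inner_diff_left inner_diff_right sym v_def[symmetric]
        inner_commute algebra_simps)
  also have "\<dots> \<le> a * a * inner v u - a * inner v v"
    using Avv by simp
  finally have "a * inner v v \<le> a * (a * inner v u)" by (simp add: mult.assoc)
  then show ?thesis using a
    by (simp add: a_def v_def power2_norm_eq_inner)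
qed

text \<open>When the square is expanded, the cross term -2 b c <A u, u> outweighs c^2 |A u|^2, by
  the preceding bound and the hypothesis on \<open>c\<close>. The estimate serves both the fixed
  point argument below and the gradient step.\<close>

lemma positive_operator_contraction:
  fixes A :: "'a::real_inner \<Rightarrow>\<^sub>L 'a"
  assumes "positive_operator A" and c: "0 \<le> c" "c * norm A \<le> b"
  shows "norm (b *\<^sub>R u - c *\<^sub>R A u) \<le> b * norm u"
proof (rule power2_le_imp_le)
  have b: "0 \<le> b" using c by (meson mult_nonneg_nonneg norm_ge_zero order_trans)
  have pos: "0 \<le> inner (A u) u" by (rule positive_operator_inner_nonneg[OF assms(1)])
  have "c\<^sup>2 * (norm (A u))\<^sup>2 \<le> c\<^sup>2 * (norm A * inner (A u) u)"
    by (intro mult_left_mono positive_operator_norm_square_le assms) simp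
  also have "\<dots> = c * (c * norm A) * inner (A u) u" by (simp add: power2_eq_square)
  also have "\<dots> \<le> c * b * inner (A u) u"
    using c pos by (intro mult_right_mono mult_left_mono) auto
  also have "\<dots> \<le> 2 * (c * b * inner (A u) u)" using b c pos by simp
  finally have *: "c\<^sup>2 * (norm (A u))\<^sup>2 \<le> 2 * (c * b * inner (A u) u)" .
  have "(norm (b *\<^sub>R u - c *\<^sub>R A u))\<^sup>2
      = b\<^sup>2 * (norm u)\<^sup>2 - 2 * (c * b * inner (A u) u) + c\<^sup>2 * (norm (A u))\<^sup>2"
    unfolding power2_norm_eq_inner
    by (simp add: inner_diff_left inner_diff_right inner_commute power2_eq_square algebra_simps)
  also have "\<dots> \<le> (b * norm u)\<^sup>2" using * by (simp add: power_mult_distrib)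
  finally show "(norm (b *\<^sub>R u - c *\<^sub>R A u))\<^sup>2 \<le> (b * norm u)\<^sup>2" .
  show "0 \<le> b * norm u" using b by simp
qed

text \<open>The equation is solved by Banach's fixed point theorem for the damped residual iteration
  \<open>T\<close>. The damping \<open>c\<close> gives \<open>c * norm A = 1 - c * a\<close>, which
  is the boundary case of the contraction lemma with \<open>b = 1 - c * a\<close>.\<close>

lemma positive_operator_shift_surj:
  fixes A :: "'a::{real_inner, complete_space} \<Rightarrow>\<^sub>L 'a"
  assumes "positive_operator A" and a: "0 < a"
  shows "\<exists>p. A p + a *\<^sub>R p = y"
proof -
  define c where "c = 1 / (norm A + a)"
  have na: "norm A + a > 0" using a by (simp add: add_nonneg_pos)
  then have c: "c > 0" by (simp add: c_def)
  have cA: "c * norm A = 1 - c * a" using na by (simp add: c_def field_simps)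
  define T where "T v = v - c *\<^sub>R (A v + a *\<^sub>R v - y)" for v
  have "dist (T u) (T v) \<le> (1 - c * a) * dist u v" for u v
  proof -
    have "T u - T v = (1 - c * a) *\<^sub>R (u - v) - c *\<^sub>R A (u - v)"
      by (simp add: T_def blinfun.bilinear_simps algebra_simps)
    then show ?thesis
      using positive_operator_contraction[OF assms(1), of c "1 - c * a" "u - v"] c cA
      by (simp add: dist_norm)
  qed
  moreover have "0 \<le> 1 - c * a" using cA c by (metis less_imp_le mult_nonneg_nonneg norm_ge_zero)
  moreover have "1 - c * a < 1" using a c by simp
  ultimately obtain p where "T p = p"
    using banach_fix_type[of "1 - c * a" T] by blast
  then have "A p + a *\<^sub>R p = y" using c by (simp add: T_def)
  then show ?thesis ..
qed

text \<open>In other words, (A + a)^(-1) A has norm at most 1. The rest \<open>m = v - p\<close>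
  satisfies \<open>A m = a *\<^sub>R p\<close>, so positivity of \<open>A\<close> at
  \<open>m\<close> makes the angle between \<open>p\<close> and \<open>m\<close> at most a right
  one, and adding \<open>m\<close> to \<open>p\<close> cannot shorten it.\<close>

lemma positive_operator_shift_norm_le:
  fixes A :: "'a::real_inner \<Rightarrow>\<^sub>L 'a"
  assumes "positive_operator A" and a: "0 < a" and p: "A p + a *\<^sub>R p = A v"
  shows "norm p \<le> norm v"
proof (rule power2_le_imp_le)
  define m where "m = v - p"
  have v: "v = p + m" by (simp add: m_def)
  have "A m = a *\<^sub>R p" using p by (simp add: m_def blinfun.bilinear_simps algebra_simps)
  moreover have "0 \<le> inner (A m) m" by (rule positive_operator_inner_nonneg[OF assms(1)])
  ultimately have "0 \<le> inner p m" using a by (simp add: zero_le_mult_iff)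
  then show "(norm p)\<^sup>2 \<le> (norm v)\<^sup>2"
    unfolding power2_norm_eq_inner v by (simp add: inner_add_left inner_add_right inner_commute)
qed simp

text \<open>The difference d = a p - b r solves (A + a) d = A ((a - b) r), so the norm bound applies
  twice: to d with shift \<open>a\<close>, then to \<open>r\<close> with shift \<open>b\<close>.
  This controls how far the auxiliary points z(a) move.\<close>

lemma positive_operator_shift_diff_le:
  fixes A :: "'a::real_inner \<Rightarrow>\<^sub>L 'a"
  assumes A: "positive_operator A" and b: "0 < b" "b \<le> a"
    and p: "A p + a *\<^sub>R p = A w" and r: "A r + b *\<^sub>R r = A w"
  shows "norm (a *\<^sub>R p - b *\<^sub>R r) \<le> (a - b) * norm w"
proof -
  have "A (a *\<^sub>R p - b *\<^sub>R r) + a *\<^sub>R (a *\<^sub>R p - b *\<^sub>R r)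
      = a *\<^sub>R (A p + a *\<^sub>R p) - b *\<^sub>R (A r + b *\<^sub>R r) - (b * (a - b)) *\<^sub>R r"
    by (simp add: blinfun.bilinear_simps algebra_simps)
  also have "\<dots> = (a - b) *\<^sub>R (A r + b *\<^sub>R r) - (b * (a - b)) *\<^sub>R r"
    unfolding p r by (simp add: algebra_simps)
  also have "\<dots> = A ((a - b) *\<^sub>R r)"
    by (simp add: blinfun.bilinear_simps algebra_simps)
  finally have "norm (a *\<^sub>R p - b *\<^sub>R r) \<le> norm ((a - b) *\<^sub>R r)"
    using b by (intro positive_operator_shift_norm_le[OF A, where a = a]) auto
  also have "\<dots> \<le> (a - b) * norm w"
    using b positive_operator_shift_norm_le[OF A b(1) r] by (simp add: mult_left_mono)
  finally show ?thesis .
qed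

section \<open>Taylor remainder and the second derivative at a minimum\<close>

text \<open>No vector-valued integral is needed: the remainder \<open>R\<close> is paired with
  itself. Along the segment, \<open>f\<close> compares this scalar with its quadratic majorant; the
  Lipschitz bound gives f' \<le> 0, and \<open>f 1 \<le> f 0\<close> yields |R|^2 \<le> (L/2) |e|^2
  |R|.\<close>

lemma taylor_lipschitz_derivative:
  fixes F :: "'a::real_inner \<Rightarrow> 'a" and F' :: "'a \<Rightarrow> 'a \<Rightarrow>\<^sub>L 'a"
  assumes F: "\<And>x. (F has_derivative blinfun_apply (F' x)) (at x)"
    and L: "\<And>x y. norm (F' x - F' y) \<le> L * norm (x - y)"
  shows "norm (F (x + e) - F x - F' x e) \<le> L / 2 * (norm e)\<^sup>2"
proof -
  define R where "R = F (x + e) - F x - F' x e"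
  define f where "f t = inner (F (x + t *\<^sub>R e)) R - t * inner (F' x e) R
      - t\<^sup>2 * (L / 2 * (norm e)\<^sup>2 * norm R)" for t
  have "f 1 \<le> f 0"
  proof (rule DERIV_nonpos_imp_nonincreasing[where f = f])
    fix t :: real
    assume t: "0 \<le> t" "t \<le> 1"
    have d: "((\<lambda>t. F (x + t *\<^sub>R e)) has_derivative (\<lambda>h. F' (x + t *\<^sub>R e) (h *\<^sub>R e))) (at t)"
      by (rule has_derivative_compose[OF _ F]) (auto intro!: derivative_eq_intros)
    have "(f has_real_derivative inner (F' (x + t *\<^sub>R e) e) R - inner (F' x e) R
        - 2 * t * (L / 2 * (norm e)\<^sup>2 * norm R)) (at t)"
      unfolding f_def has_field_derivative_def
      by (auto intro!: derivative_eq_intros d ext simp: blinfun.bilinear_simps algebra_simps)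
    moreover have "inner (F' (x + t *\<^sub>R e) e) R - inner (F' x e) R
        \<le> 2 * t * (L / 2 * (norm e)\<^sup>2 * norm R)"
    proof -
      have "inner (F' (x + t *\<^sub>R e) e) R - inner (F' x e) R = inner ((F' (x + t *\<^sub>R e) - F' x) e) R"
        by (simp add: blinfun.bilinear_simps inner_diff_left)
      also have "\<dots> \<le> norm ((F' (x + t *\<^sub>R e) - F' x) e) * norm R" by (rule norm_cauchy_schwarz)
      also have "\<dots> \<le> (norm (F' (x + t *\<^sub>R e) - F' x) * norm e) * norm R"
        by (intro mult_right_mono norm_blinfun) simp
      also have "\<dots> \<le> (L * norm (x + t *\<^sub>R e - x) * norm e) * norm R"
        by (intro mult_right_mono L) simp_all
      also have "\<dots> = 2 * t * (L / 2 * (norm e)\<^sup>2 * norm R)"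
        using t by (simp add: power2_eq_square)
      finally show ?thesis .
    qed
    ultimately show "\<exists>y. (f has_real_derivative y) (at t) \<and> y \<le> 0"
      by (intro exI conjI) auto
  qed simp
  then have "inner R R \<le> L / 2 * (norm e)\<^sup>2 * norm R"
    by (simp add: f_def R_def inner_diff_left)
  then have "norm R * norm R \<le> L / 2 * (norm e)\<^sup>2 * norm R"
    by (simp add: power2_norm_eq_inner[symmetric] power2_eq_square)
  \<comment> \<open>The sign of \<open>L\<close> is not assumed; for nonzero \<open>e\<close> it
    follows from the Lipschitz bound at \<open>x + e\<close> and \<open>x\<close>, and for
    \<open>e = 0\<close> the claim is trivial.\<close>
  moreover have "0 \<le> L / 2 * (norm e)\<^sup>2"
  proof -
    have "0 \<le> L * norm e" using L[of "x + e" x] by (simp add: order_trans[OF norm_ge_zero])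
    then show ?thesis by (auto simp: zero_le_mult_iff)
  qed
  ultimately show ?thesis
    unfolding R_def[symmetric] by (cases "R = 0") simp_all
qed

lemma gderiv_line:
  fixes J :: "'a::real_inner \<Rightarrow> real"
  assumes "\<And>x. GDERIV J x :> J' x"
  shows "((\<lambda>t. J (x + t *\<^sub>R h)) has_real_derivative inner h (J' (x + t *\<^sub>R h))) (at t)"
proof -
  have "((\<lambda>t. J (x + t *\<^sub>R h)) has_derivative (\<lambda>u. inner (u *\<^sub>R h) (J' (x + t *\<^sub>R h)))) (at t)"
    by (rule has_derivative_compose[OF _ assms[unfolded gderiv_def]])
      (auto intro!: derivative_eq_intros)
  then show ?thesis unfolding has_field_derivative_def by (simp add: mult_commute_abs)
qed

lemma le_zero_if_le_small:
  fixes a C :: real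
  assumes "\<And>t. 0 < t \<Longrightarrow> t \<le> 1 \<Longrightarrow> a \<le> t * C"
  shows "a \<le> 0"
proof (rule tendsto_lowerbound)
  show "((\<lambda>t. t * C) \<longlongrightarrow> 0) (at_right (0::real))"
    by (auto intro!: tendsto_eq_intros)
  show "\<forall>\<^sub>F t in at_right 0. a \<le> t * C"
    unfolding eventually_at_right_field using assms by (intro exI[of _ 1]) auto
qed simp

text \<open>Both inner products are the limit of the same symmetric second difference of \<open>J\<close>,
  divided by \<open>t\<^sup>2\<close>.\<close>

lemma second_derivative_symmetric:
  fixes J :: "'a::real_inner \<Rightarrow> real" and A :: "'a \<Rightarrow>\<^sub>L 'a"
  assumes J: "\<And>x. GDERIV J x :> J' x"
    and C: "0 \<le> C" "\<And>y. norm (J' (x + y) - J' x - A y) \<le> C * (norm y)\<^sup>2"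
  shows "inner (A h) k = inner h (A k)"
proof -
  define D where "D t = J (x + t *\<^sub>R h + t *\<^sub>R k) - J (x + t *\<^sub>R h) - J (x + t *\<^sub>R k) + J x" for t
  define B where "B = 2 * C * (norm h + norm k)\<^sup>2 * (norm h + norm k)"
  have D: "\<bar>J (x + t *\<^sub>R h + t *\<^sub>R k) - J (x + t *\<^sub>R h) - J (x + t *\<^sub>R k) + J x
        - t\<^sup>2 * inner h (A k)\<bar> \<le> t ^ 3 * (2 * C * (norm h + norm k)\<^sup>2 * (norm h + norm k))"
    if t: "0 < t" for t h k
  proof -
    define M where "M = (norm h + norm k)"
    \<comment> \<open>\<open>f\<close> is a first difference of \<open>J\<close> in direction
      \<open>k\<close>, so \<open>f 1 - f 0\<close> is the second difference and the mean value
      theorem acts in direction \<open>h\<close>.\<close>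
    define f where "f \<tau> = J ((x + t *\<^sub>R k) + \<tau> *\<^sub>R (t *\<^sub>R h)) - J (x + \<tau> *\<^sub>R (t *\<^sub>R h))" for \<tau>
    have "\<exists>\<tau>>0. \<tau> < 1 \<and> f 1 - f 0 = (1 - 0) * (inner (t *\<^sub>R h) (J' ((x + t *\<^sub>R k) + \<tau> *\<^sub>R (t *\<^sub>R h)))
        - inner (t *\<^sub>R h) (J' (x + \<tau> *\<^sub>R (t *\<^sub>R h))))"
      unfolding f_def
      by (rule MVT2) (simp, intro DERIV_diff gderiv_line[OF J])
    then obtain \<tau> where \<tau>: "0 < \<tau>" "\<tau> < 1"
      and eq: "f 1 - f 0 = inner (t *\<^sub>R h) (J' ((x + t *\<^sub>R k) + \<tau> *\<^sub>R (t *\<^sub>R h)))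
        - inner (t *\<^sub>R h) (J' (x + \<tau> *\<^sub>R (t *\<^sub>R h)))" by auto
    define r where "r y = J' (x + y) - J' x - A y" for y
    have r: "norm (r y) \<le> C * (t * M)\<^sup>2" if "norm y \<le> t * M" for y
    proof -
      have "norm (r y) \<le> C * (norm y)\<^sup>2" unfolding r_def by (rule C)
      also have "\<dots> \<le> C * (t * M)\<^sup>2" using that C by (intro mult_left_mono power_mono) auto
      finally show ?thesis .
    qed
    have n: "norm (\<tau> *\<^sub>R (t *\<^sub>R h)) \<le> t * norm h"
      using \<tau> t by (simp add: mult_left_le_one_le)
    have n1: "norm (\<tau> *\<^sub>R (t *\<^sub>R h)) \<le> t * M"
      by (rule order_trans[OF n]) (use t in \<open>simp add: M_def\<close>)
    have n2: "norm (t *\<^sub>R k + \<tau> *\<^sub>R (t *\<^sub>R h)) \<le> t * M"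
      by (rule order_trans[OF norm_triangle_ineq]) (use n t in \<open>simp add: M_def distrib_left\<close>)
    \<comment> \<open>After linearising both gradients at \<open>x\<close>, the parts A (\<tau> t h)
      cancel, so the unknown \<tau> survives only in the remainders \<open>r\<close>, which are of
      order t^2.\<close>
    have "f 1 - f 0 - t\<^sup>2 * inner h (A k)
      = inner (t *\<^sub>R h) (r (t *\<^sub>R k + \<tau> *\<^sub>R (t *\<^sub>R h)) - r (\<tau> *\<^sub>R (t *\<^sub>R h)))"
      unfolding eq r_def
      by (simp add: blinfun.bilinear_simps inner_diff_right inner_add_right power2_eq_square
          add.assoc algebra_simps)
    also have "\<bar>\<dots>\<bar> \<le> norm (t *\<^sub>R h) * norm (r (t *\<^sub>R k + \<tau> *\<^sub>R (t *\<^sub>R h)) - r (\<tau> *\<^sub>R (t *\<^sub>R h)))"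
      by (rule Cauchy_Schwarz_ineq2)
    also have "\<dots> \<le> (t * M) * (C * (t * M)\<^sup>2 + C * (t * M)\<^sup>2)"
    proof (rule mult_mono)
      show "norm (t *\<^sub>R h) \<le> t * M" using t by (simp add: M_def)
      show "norm (r (t *\<^sub>R k + \<tau> *\<^sub>R (t *\<^sub>R h)) - r (\<tau> *\<^sub>R (t *\<^sub>R h)))
          \<le> C * (t * M)\<^sup>2 + C * (t * M)\<^sup>2"
        by (rule order_trans[OF norm_triangle_ineq4]) (intro add_mono r n1 n2)
      show "0 \<le> t * M" using t by (simp add: M_def)
    qed simp
    also have "\<dots> = t ^ 3 * (2 * C * M\<^sup>2 * M)"
      by (simp add: power2_eq_square power3_eq_cube)
    finally show ?thesis by (simp add: f_def M_def algebra_simps)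
  qed
  have "\<bar>inner h (A k) - inner k (A h)\<bar> \<le> 0"
  proof (rule le_zero_if_le_small[where C = "2 * B"])
    fix t :: real
    assume t: "0 < t"
    \<comment> \<open>Both \<open>D\<close> and \<open>B\<close> are unchanged when \<open>h\<close>
      and \<open>k\<close> are swapped, so the same estimate can be used twice.\<close>
    have "\<bar>D t - t\<^sup>2 * inner h (A k)\<bar> \<le> t ^ 3 * B" "\<bar>D t - t\<^sup>2 * inner k (A h)\<bar> \<le> t ^ 3 * B"
      using D[OF t, of h k] D[OF t, of k h] by (simp_all add: D_def B_def algebra_simps)
    then have "\<bar>t\<^sup>2 * inner h (A k) - t\<^sup>2 * inner k (A h)\<bar> \<le> 2 * (t ^ 3 * B)" by linarith
    then have "t\<^sup>2 * \<bar>inner h (A k) - inner k (A h)\<bar> \<le> t\<^sup>2 * (t * (2 * B))"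
      by (simp add: right_diff_distrib[symmetric] abs_mult power2_eq_square power3_eq_cube)
    then show "\<bar>inner h (A k) - inner k (A h)\<bar> \<le> t * (2 * B)" using t by simp
  qed
  then show ?thesis by (simp add: inner_commute)
qed

lemma gderiv_minimum_eq_zero:
  fixes J :: "'a::real_inner \<Rightarrow> real"
  assumes "GDERIV J x :> g" and "\<And>y. J x \<le> J y"
  shows "g = 0"
proof -
  have "(\<lambda>h. inner h g) = (\<lambda>h. 0)"
    by (rule has_derivative_local_min[OF assms(1)[unfolded gderiv_def]])
      (simp add: assms(2))
  then show ?thesis by (metis inner_eq_zero_iff)
qed

text \<open>Nonnegativity: since \<open>J' x = 0\<close>, the mean value theorem and minimality give
  some \<tau> in (0, t) with 0 \<le> <u, J'(x + \<tau> u)> = \<tau> <A u, u> + O(\<tau>^2). Divide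
  by \<tau> and let t tend to 0.\<close>

lemma positive_operator_second_derivative_minimum:
  fixes J :: "'a::real_inner \<Rightarrow> real" and A :: "'a \<Rightarrow>\<^sub>L 'a"
  assumes J: "\<And>x. GDERIV J x :> J' x"
    and C: "0 \<le> C" "\<And>y. norm (J' (x + y) - J' x - A y) \<le> C * (norm y)\<^sup>2"
    and min: "\<And>y. J x \<le> J y"
  shows "positive_operator A"
  unfolding positive_operator_def
proof (intro conjI allI)
  show "inner (A u) v = inner u (A v)" for u v
    by (rule second_derivative_symmetric[OF J C])
  fix u
  have J0: "J' x = 0" by (rule gderiv_minimum_eq_zero[OF J min])
  have "- inner (A u) u \<le> 0"
  proof (rule le_zero_if_le_small[where C = "C * (norm u)\<^sup>2 * norm u"])
    fix t :: real
    assume t: "0 < t"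
    have "\<exists>\<tau>>0. \<tau> < t \<and> J (x + t *\<^sub>R u) - J (x + 0 *\<^sub>R u) = (t - 0) * inner u (J' (x + \<tau> *\<^sub>R u))"
      by (rule MVT2[OF t]) (rule gderiv_line[OF J])
    then obtain \<tau> where \<tau>: "0 < \<tau>" "\<tau> < t" and eq: "J (x + t *\<^sub>R u) - J x = t * inner u (J' (x + \<tau> *\<^sub>R u))"
      by auto
    have "0 \<le> t * inner u (J' (x + \<tau> *\<^sub>R u))" using min[of "x + t *\<^sub>R u"] eq by simp
    then have "0 \<le> inner u (J' (x + \<tau> *\<^sub>R u))" using t by (simp add: zero_le_mult_iff)
    also have "\<dots> = \<tau> * inner (A u) u + inner u (J' (x + \<tau> *\<^sub>R u) - J' x - A (\<tau> *\<^sub>R u))"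
      by (simp add: J0 blinfun.bilinear_simps inner_diff_right inner_commute)
    also have "inner u (J' (x + \<tau> *\<^sub>R u) - J' x - A (\<tau> *\<^sub>R u))
        \<le> norm u * norm (J' (x + \<tau> *\<^sub>R u) - J' x - A (\<tau> *\<^sub>R u))" by (rule norm_cauchy_schwarz)
    also have "\<dots> \<le> norm u * (C * (norm (\<tau> *\<^sub>R u))\<^sup>2)" by (intro mult_left_mono C) simp
    also have "\<dots> = \<tau> * (\<tau> * (C * (norm u)\<^sup>2 * norm u))" by (simp add: power2_eq_square)
    finally have "0 \<le> \<tau> * (inner (A u) u + \<tau> * (C * (norm u)\<^sup>2 * norm u))" by (simp add: distrib_left)
    then have "- inner (A u) u \<le> \<tau> * (C * (norm u)\<^sup>2 * norm u)"
      using \<tau> by (simp add: zero_le_mult_iff)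
    also have "\<dots> \<le> t * (C * (norm u)\<^sup>2 * norm u)"
      using \<tau> C(1) by (intro mult_right_mono) auto
    finally show "- inner (A u) u \<le> t * (C * (norm u)\<^sup>2 * norm u)" .
  qed
  then show "0 \<le> inner (A u) u" by simp
qed

section \<open>Decay of the regularization parameters\<close>

text \<open>The decrement is at most \<beta>(m) / m, of order m^(-s-1), while \<beta>(m)^3 is of
  order m^(-3s). The quotient is of order m^(2s-1), which tends to 0 because s < 1/2.\<close>

lemma eventually_powr_decrement_le:
  fixes \<alpha>0 s r \<epsilon> :: real
  assumes "0 < \<alpha>0" "0 < s" "s < 1 / 2" "0 \<le> r" "0 < \<epsilon>"
  defines "\<beta> \<equiv> \<lambda>m::nat. \<alpha>0 * real m powr (- s)"
  shows "\<forall>\<^sub>F m in sequentially. r * (\<beta> m - \<beta> (Suc m)) \<le> \<epsilon> * \<beta> m ^ 3"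
proof -
  have "((\<lambda>m::nat. r * real m powr (2 * s - 1)) \<longlongrightarrow> r * 0) sequentially"
    using assms by (intro tendsto_mult tendsto_const tendsto_neg_powr filterlim_real_sequentially) auto
  then have "\<forall>\<^sub>F m::nat in sequentially. r * real m powr (2 * s - 1) < \<epsilon> * \<alpha>0\<^sup>2"
    using assms by (intro order_tendstoD(2)[of _ 0]) auto
  then show ?thesis using eventually_gt_at_top[of 0]
  proof eventually_elim
    case (elim m)
    define x where "x = real m"
    have x: "x > 0" using elim by (simp add: x_def)
    define P where "P = x powr (- s)"
    have P: "P > 0" using x by (simp add: P_def)
    \<comment> \<open>A Bernoulli-type bound: the exponent -1 suffices, since -1 \<le> -s and the
      base is at least 1.\<close>
    have "1 - 1 / x \<le> (1 + 1 / x) powr (- 1)"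
      using x by (simp add: powr_minus_divide field_simps)
    also have "\<dots> \<le> (1 + 1 / x) powr (- s)"
      using x assms by (intro powr_mono) auto
    finally have "1 - 1 / x \<le> (1 + 1 / x) powr (- s)" .
    moreover have "real (Suc m) = x * (1 + 1 / x)" using x by (simp add: x_def field_simps)
    then have "real (Suc m) powr (- s) = P * (1 + 1 / x) powr (- s)"
      using x by (simp add: P_def powr_mult)
    ultimately have "P * (1 - 1 / x) \<le> real (Suc m) powr (- s)"
      using P by simp
    then have "P - real (Suc m) powr (- s) \<le> P / x" by (simp add: right_diff_distrib)
    then have "\<alpha>0 * (P - real (Suc m) powr (- s)) \<le> \<alpha>0 * (P / x)"
      using assms by (intro mult_left_mono) auto
    then have diff: "\<beta> m - \<beta> (Suc m) \<le> \<alpha>0 * (P / x)"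
      by (simp add: \<beta>_def P_def x_def right_diff_distrib)
    \<comment> \<open>The exponent -1 of 1/x is split as (2s - 1) - 2s, separating the vanishing
      factor from \<open>P\<^sup>2\<close>.\<close>
    have "x powr (2 * s - 1) * P\<^sup>2 = x powr ((2 * s - 1) + (- s + - s))"
      by (simp only: P_def power2_eq_square powr_add)
    then have "1 / x = x powr (2 * s - 1) * P\<^sup>2"
      using x by (simp add: powr_minus_divide)
    then have Px: "P / x = x powr (2 * s - 1) * P ^ 3"
      by (metis (no_types, lifting) mult.commute mult.left_commute mult_1 power2_eq_square
          power3_eq_cube times_divide_eq_left)
    have "r * (\<beta> m - \<beta> (Suc m)) \<le> r * (\<alpha>0 * (P / x))"
      using assms diff by (intro mult_left_mono) auto
    also have "r * (\<alpha>0 * (P / x)) = (r * x powr (2 * s - 1)) * (\<alpha>0 * P ^ 3)"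
      by (simp add: Px)
    also have "\<dots> \<le> (\<epsilon> * \<alpha>0\<^sup>2) * (\<alpha>0 * P ^ 3)"
      using elim P assms by (intro mult_right_mono) (auto simp: x_def)
    also have "\<dots> = \<epsilon> * \<beta> m ^ 3"
      by (simp add: \<beta>_def P_def x_def power_mult_distrib power2_eq_square power3_eq_cube)
    finally show ?case .
  qed
qed

section \<open>One gradient step and the induction\<close>

text \<open>The hypothesis \<open>decr\<close> is a budget. Contraction of the radius q a gains 2 q
  \<mu> a^3; this must pay \<mu> a \<rho> for the perturbation, q (a - b) for shrinking the radius
  to q b, and 2 |w| (a - b) for moving the centre from z(a) to z(b).\<close>

lemma reg_gradient_step:
  fixes A :: "'a::real_inner \<Rightarrow>\<^sub>L 'a"
  assumes A: "positive_operator A" and b: "0 < b" "b \<le> a"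
    and source: "xstar - \<xi> = A w"
    and p: "A p + (2 * a) *\<^sub>R p = A w" and p': "A p' + (2 * b) *\<^sub>R p' = A w"
    and \<mu>: "0 < \<mu>" "\<mu> * a * (norm A + 2 * a) \<le> 1"
    and r: "norm (g - A (x - xstar)) \<le> \<rho>"
    and decr: "(q + 2 * norm w) * (a - b) + \<mu> * a * \<rho> \<le> 2 * q * \<mu> * a ^ 3"
    and x: "norm (x - (xstar - (2 * a) *\<^sub>R p)) \<le> q * a"
  shows "norm (x - (\<mu> * a) *\<^sub>R (g + (2 * a) *\<^sub>R (x - \<xi>)) - (xstar - (2 * b) *\<^sub>R p')) \<le> q * b"
proof -
  define u where "u = x - (xstar - (2 * a) *\<^sub>R p)"
  define c where "c = \<mu> * a"
  define R where "R = g - A (x - xstar)"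
  have a: "0 < a" and c: "0 \<le> c" using b \<mu> by (auto simp: c_def)
  have "x - xstar = u - (2 * a) *\<^sub>R p" and "x - \<xi> = u - (2 * a) *\<^sub>R p + A w"
    using source by (auto simp: u_def algebra_simps)
  \<comment> \<open>Since z(a) is a zero of the linearised regularised gradient, that gradient at
    \<open>x\<close> reduces to A u + 2 a u; the rest is the perturbation \<open>R\<close> and the
    shift of the centre.\<close>
  then have eq: "x - c *\<^sub>R (g + (2 * a) *\<^sub>R (x - \<xi>)) - (xstar - (2 * b) *\<^sub>R p')
      = ((1 - 2 * a * c) *\<^sub>R u - c *\<^sub>R A u) - c *\<^sub>R R - ((2 * a) *\<^sub>R p - (2 * b) *\<^sub>R p')"
    unfolding R_def p[symmetric] by (simp add: u_def blinfun.bilinear_simps algebra_simps)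
  \<comment> \<open>The step size condition is exactly what the contraction lemma requires for the
    factor 1 - 2 a c.\<close>
  have c1: "c * norm A \<le> 1 - 2 * a * c" using \<mu> by (simp add: c_def algebra_simps)
  then have "0 \<le> 1 - 2 * a * c" using c by (meson mult_nonneg_nonneg norm_ge_zero order_trans)
  then have "norm ((1 - 2 * a * c) *\<^sub>R u - c *\<^sub>R A u) \<le> (1 - 2 * a * c) * (q * a)"
    by (intro order_trans[OF positive_operator_contraction[OF A c c1]] mult_left_mono)
      (use x in \<open>auto simp: u_def\<close>)
  moreover have "norm (c *\<^sub>R R) \<le> c * \<rho>"
    using r c by (simp add: R_def mult_left_mono)
  moreover have "norm ((2 * a) *\<^sub>R p - (2 * b) *\<^sub>R p') \<le> (2 * a - 2 * b) * norm w"
    using b by (intro positive_operator_shift_diff_le[OF A _ _ p p']) auto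
  ultimately have "norm (x - c *\<^sub>R (g + (2 * a) *\<^sub>R (x - \<xi>)) - (xstar - (2 * b) *\<^sub>R p'))
      \<le> (1 - 2 * a * c) * (q * a) + c * \<rho> + (2 * a - 2 * b) * norm w"
    unfolding eq
    by (meson add_mono norm_triangle_le_diff)
  also have "\<dots> \<le> q * b"
    using decr by (simp add: c_def algebra_simps power3_eq_cube)
  finally show ?thesis by (simp add: c_def)
qed

text \<open>Exact and noisy data are treated together through a free horizon \<open>N\<close>. The
  noise condition is asked only for n < N, because reaching index n + 1 uses the gradient at index
  n; the bound therefore still holds at \<open>N\<close> itself.\<close>

lemma reg_gradient_iteration_bound:
  fixes A :: "'a::{real_inner, complete_space} \<Rightarrow>\<^sub>L 'a" and \<alpha> :: "nat \<Rightarrow> real"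
  assumes A: "positive_operator A"
    and source: "xstar - \<xi> = A w"
    and J': "\<And>y. norm (J' y - A (y - xstar)) \<le> L / 2 * (norm (y - xstar))\<^sup>2"
    and G: "\<And>y. norm (G y - J' y) \<le> \<delta> * (1 + norm (y - \<xi>))"
    and \<mu>: "0 < \<mu>" and L: "0 \<le> L" and q: "0 < q" and \<delta>: "0 \<le> \<delta>"
    and \<alpha>: "\<And>n. 1 \<le> n \<Longrightarrow> 0 < \<alpha> n" "\<And>n. 1 \<le> n \<Longrightarrow> \<alpha> (Suc n) \<le> \<alpha> n"
    and step: "\<And>n. 1 \<le> n \<Longrightarrow> \<mu> * \<alpha> n * (norm A + 2 * \<alpha> n) \<le> 1"
    and decr: "\<And>n. 1 \<le> n \<Longrightarrow>
      (q + 2 * norm w) * (\<alpha> n - \<alpha> (Suc n)) \<le> (1 - \<theta>) * Phi L w q * \<mu> * \<alpha> n ^ 3"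
    and noise: "\<And>n. 1 \<le> n \<Longrightarrow> n < N \<Longrightarrow> \<delta> * C9 A w q (\<alpha> 1) \<le> \<theta> * Phi L w q * (\<alpha> n)\<^sup>2"
    and x1: "norm (x 1 - xstar) \<le> (q - 2 * norm w) * \<alpha> 1"
    and x: "reg_gradient_iteration G \<xi> \<mu> \<alpha> x"
    and n: "1 \<le> n" "n \<le> N"
  shows "norm (x n - xstar) \<le> (q + 2 * norm w) * \<alpha> n"
proof -
  \<comment> \<open>Thus \<open>xstar - (2 * \<alpha> n) *\<^sub>R p n\<close> is the auxiliary
    point z(\<open>\<alpha> n\<close>).\<close>
  define p where "p n = (SOME v. A v + (2 * \<alpha> n) *\<^sub>R v = A w)" for n
  have p: "A (p n) + (2 * \<alpha> n) *\<^sub>R p n = A w" if "1 \<le> n" for n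
    unfolding p_def by (rule someI_ex) (use that \<alpha> in \<open>auto intro!: positive_operator_shift_surj A\<close>)
  have np: "norm ((2 * \<alpha> n) *\<^sub>R p n) \<le> 2 * norm w * \<alpha> n" if "1 \<le> n" for n
    using positive_operator_shift_norm_le[OF A _ p[OF that]] \<alpha>(1)[OF that] by simp
  have \<alpha>1: "\<alpha> n \<le> \<alpha> 1" if "1 \<le> n" for n
    using that by (induction n rule: nat_induct_at_least) (auto intro: order_trans[OF \<alpha>(2)])
  have close: "norm (x n - xstar) \<le> (q + 2 * norm w) * \<alpha> n"
    if "1 \<le> n" "norm (x n - (xstar - (2 * \<alpha> n) *\<^sub>R p n)) \<le> q * \<alpha> n" for n
  proof -
    have "norm (x n - xstar)
        \<le> norm (x n - (xstar - (2 * \<alpha> n) *\<^sub>R p n)) + norm ((2 * \<alpha> n) *\<^sub>R p n)"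
      using norm_triangle_ineq4[of "x n - (xstar - (2 * \<alpha> n) *\<^sub>R p n)" "(2 * \<alpha> n) *\<^sub>R p n"] by simp
    then show ?thesis using that(2) np[OF that(1)] by (simp add: distrib_right)
  qed
  have "norm (x n - (xstar - (2 * \<alpha> n) *\<^sub>R p n)) \<le> q * \<alpha> n"
    using n
  proof (induction n rule: dec_induct)
    case base
    \<comment> \<open>The starting radius (q - 2 |w|) \<alpha>(1) leaves room for the distance 2 |w|
      \<alpha>(1) from \<open>xstar\<close> to the first centre.\<close>
    have "norm (x 1 - (xstar - (2 * \<alpha> 1) *\<^sub>R p 1))
        \<le> norm (x 1 - xstar) + norm ((2 * \<alpha> 1) *\<^sub>R p 1)"
      using norm_triangle_ineq[of "x 1 - xstar" "(2 * \<alpha> 1) *\<^sub>R p 1"] by (simp add: algebra_simps)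
    then show ?case using x1 np[of 1] by (simp add: left_diff_distrib)
  next
    case (step n)
    define r where "r = q + 2 * norm w"
    have r: "0 < r" using q by (simp add: r_def add_pos_nonneg)
    have n1: "1 \<le> n" and nN: "n < N" using step by auto
    have IH: "norm (x n - (xstar - (2 * \<alpha> n) *\<^sub>R p n)) \<le> q * \<alpha> n" using step by simp
    have e: "norm (x n - xstar) \<le> r * \<alpha> n"
      unfolding r_def using n1 IH by (rule close)
    have "norm (J' (x n) - A (x n - xstar)) \<le> L / 2 * (norm (x n - xstar))\<^sup>2" by (rule J')
    also have "\<dots> \<le> L / 2 * (r * \<alpha> n)\<^sup>2"
      using L e by (intro mult_left_mono power_mono) auto
    finally have J'_bound: "norm (J' (x n) - A (x n - xstar)) \<le> L / 2 * (r * \<alpha> n)\<^sup>2" .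
    have "norm (x n - \<xi>) \<le> norm (x n - xstar) + norm (A w)"
      using norm_triangle_ineq[of "x n - xstar" "xstar - \<xi>"] by (simp add: source[symmetric])
    also have "\<dots> \<le> r * \<alpha> 1 + norm (A w)"
      using e \<alpha>1[OF n1] r by (meson add_right_mono mult_left_mono less_imp_le order_trans)
    finally have "1 + norm (x n - \<xi>) \<le> C9 A w q (\<alpha> 1)" by (simp add: C9_def r_def)
    then have "\<delta> * (1 + norm (x n - \<xi>)) \<le> \<delta> * C9 A w q (\<alpha> 1)"
      using \<delta> by (rule mult_left_mono)
    then have G_bound: "norm (G (x n) - J' (x n)) \<le> \<theta> * Phi L w q * (\<alpha> n)\<^sup>2"
      using G[of "x n"] noise[OF n1 nN] by linarith
    define \<rho> where "\<rho> = \<theta> * Phi L w q * (\<alpha> n)\<^sup>2 + L / 2 * (r * \<alpha> n)\<^sup>2"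
    have \<rho>: "norm (G (x n) - A (x n - xstar)) \<le> \<rho>"
      using norm_triangle_mono[OF G_bound J'_bound] by (simp add: \<rho>_def)
    have "(q + 2 * norm w) * (\<alpha> n - \<alpha> (Suc n)) + \<mu> * \<alpha> n * \<rho>
        \<le> (1 - \<theta>) * Phi L w q * \<mu> * \<alpha> n ^ 3 + \<mu> * \<alpha> n * \<rho>"
      using decr[OF n1] by simp
    \<comment> \<open>The shares \<theta> and 1 - \<theta> add up to all of \<Phi>(q). Adding the
      Taylor term L r^2 / 2 leaves 2 q - 4 |w|, which is at most 2 q.\<close>
    also have "\<dots> = (Phi L w q + L / 2 * r\<^sup>2) * (\<mu> * \<alpha> n ^ 3)"
      by (simp add: \<rho>_def power2_eq_square power3_eq_cube algebra_simps)
    also have "\<dots> \<le> 2 * q * (\<mu> * \<alpha> n ^ 3)"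
      using \<mu> \<alpha>(1)[OF n1] by (intro mult_right_mono) (auto simp: Phi_def r_def)
    finally have "norm (x n - (\<mu> * \<alpha> n) *\<^sub>R (G (x n) + (2 * \<alpha> n) *\<^sub>R (x n - \<xi>))
        - (xstar - (2 * \<alpha> (Suc n)) *\<^sub>R p (Suc n))) \<le> q * \<alpha> (Suc n)"
      by (intro reg_gradient_step[OF A _ _ source p p \<mu> _ \<rho> _ IH] \<alpha>
          \<open>\<And>n. 1 \<le> n \<Longrightarrow> \<mu> * \<alpha> n * (norm A + 2 * \<alpha> n) \<le> 1\<close>)
        (use n1 in \<open>auto simp: mult.assoc\<close>)
    then show ?case using x n1 by (simp add: reg_gradient_iteration_def)
  qed
  then show ?thesis using n(1) by (intro close)
qed

section \<open>Choice of parameters and conclusion\<close>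

lemma reg_param_tendsto_0:
  assumes "0 < s"
  shows "reg_param \<alpha>0 s k \<longlonglongrightarrow> 0"
proof -
  have "(\<lambda>n. real (n + k) powr (- s)) \<longlonglongrightarrow> 0"
    using assms by (intro tendsto_neg_powr filterlim_compose[OF filterlim_real_sequentially]
        filterlim_add_const_nat_at_top) auto
  then have "(\<lambda>n. \<alpha>0 * real (n + k) powr (- s)) \<longlonglongrightarrow> \<alpha>0 * 0"
    by (intro tendsto_intros)
  then show ?thesis by (simp add: reg_param_def[abs_def])
qed

text \<open>In the variable r = q + 2 |w|, \<Phi> is the concave parabola 2 r - 8 |w| - L r^2 / 2.
  The witness is its vertex r = 2/L, where the value 2/L - 8 |w| is positive exactly when L |w| <
  1/4.\<close>

lemma ex_Phi_pos:
  assumes "0 < L" "L * norm w < 1 / 4"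
  shows "\<exists>q>0. Phi L w q > 0"
proof (intro exI conjI)
  show "0 < 2 / L - 2 * norm w" using assms by (simp add: field_simps)
  have "Phi L w (2 / L - 2 * norm w) = 2 / L - 8 * norm w"
    using assms by (simp add: Phi_def power2_eq_square)
  moreover have "8 * norm w < 2 / L" using assms by (simp add: field_simps)
  ultimately show "0 < Phi L w (2 / L - 2 * norm w)" by simp
qed

lemma Phi_pos_imp_less:
  assumes "0 \<le> L" "Phi L w q > 0"
  shows "2 * norm w < q"
proof -
  have "0 \<le> L / 2 * (q + 2 * norm w)\<^sup>2" using assms by simp
  then show ?thesis using assms(2) unfolding Phi_def by linarith
qed

theorem theorem5p1:
  fixes J :: "'a::{real_inner, complete_space} \<Rightarrow> real"
    and J' :: "'a \<Rightarrow> 'a"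
    and J'' :: "'a \<Rightarrow> 'a \<Rightarrow>\<^sub>L 'a"
    and xstar \<xi> w :: 'a
    and L \<theta> \<mu> \<alpha>0 s :: real
  assumes "\<And>x. GDERIV J x :> J' x"
    and "\<And>x. (J' has_derivative blinfun_apply (J'' x)) (at x)"
    and "continuous_on UNIV J''"
    and "\<And>x. J xstar \<le> J x"
    and "0 < L"
    and "\<And>x y. norm (J'' x - J'' y) \<le> L * norm (x - y)"
    and "xstar - \<xi> = blinfun_apply (J'' xstar) w"
    and "L * norm w < 1 / 4"
    and "0 < \<theta>" and "\<theta> < 1"
    and "0 < \<mu>"
    and "0 < \<alpha>0"
    and "0 < s" and "s < 1 / 2"
  shows "(\<exists>q>0. Phi L w q > 0) \<and>
    (\<forall>q>0. Phi L w q > 0 \<longrightarrow>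
      2 * norm w < q \<and>
      (\<exists>k0\<ge>1. \<forall>k\<ge>k0. \<forall>\<delta>\<ge>0. \<forall>(J\<delta> :: 'a \<Rightarrow> real) (J\<delta>' :: 'a \<Rightarrow> 'a) (x :: nat \<Rightarrow> 'a).
        (\<forall>z. GDERIV J\<delta> z :> J\<delta>' z) \<longrightarrow>
        (\<forall>z. norm (J\<delta>' z - J' z) \<le> \<delta> * (1 + norm (z - \<xi>))) \<longrightarrow>
        (\<delta> = 0 \<longrightarrow> J\<delta> = J) \<longrightarrow>
        norm (x 1 - xstar) \<le> (q - 2 * norm w) * reg_param \<alpha>0 s k 1 \<longrightarrow>
        reg_gradient_iteration J\<delta>' \<xi> \<mu> (reg_param \<alpha>0 s k) x \<longrightarrow>
          (\<delta> = 0 \<longrightarrow>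
            (\<forall>n\<ge>1. norm (x n - xstar) \<le> (q + 2 * norm w) * reg_param \<alpha>0 s k n)) \<and>
          (\<delta> > 0 \<longrightarrow>
            (\<forall>K2. K2 \<ge> sqrt (C9 (J'' xstar) w q (reg_param \<alpha>0 s k 1) / (\<theta> * Phi L w q)) \<longrightarrow>
              norm (x (stopping_index (reg_param \<alpha>0 s k) K2 \<delta>) - xstar)
                \<le> (q + 2 * norm w) * K2 * sqrt \<delta>))))"
proof (intro conjI allI impI)
  show "\<exists>q>0. Phi L w q > 0" by (rule ex_Phi_pos[OF assms(5,8)])
  fix q :: real
  assume q: "0 < q" and Phi: "0 < Phi L w q"
  show "2 * norm w < q" using assms(5) Phi by (intro Phi_pos_imp_less) auto
  define A where "A = J'' xstar"
  \<comment> \<open>Since \<alpha>(n) = \<beta>(n + k), asymptotic properties of \<beta> hold for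
    all n at once when k is large. The threshold is fixed before \<delta> and the perturbed
    functional appear, hence is independent of them.\<close>
  define \<beta> where "\<beta> m = \<alpha>0 * real m powr (- s)" for m :: nat
  have taylor: "norm (J' (xstar + y) - J' xstar - A y) \<le> L / 2 * (norm y)\<^sup>2" for y
    unfolding A_def by (rule taylor_lipschitz_derivative[OF assms(2,6)])
  have A: "positive_operator A"
    using assms(5) by (intro positive_operator_second_derivative_minimum[OF assms(1) _ taylor assms(4)]) simp
  have "J' xstar = 0" by (rule gderiv_minimum_eq_zero[OF assms(1,4)])
  then have J': "norm (J' y - A (y - xstar)) \<le> L / 2 * (norm (y - xstar))\<^sup>2" for y
    using taylor[of "y - xstar"] by simp
  have "((\<lambda>m. \<mu> * reg_param \<alpha>0 s 0 m * (norm A + 2 * reg_param \<alpha>0 s 0 m))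
      \<longlongrightarrow> \<mu> * 0 * (norm A + 2 * 0)) sequentially"
    by (intro tendsto_intros reg_param_tendsto_0 assms)
  then have "\<forall>\<^sub>F m in sequentially. \<mu> * \<beta> m * (norm A + 2 * \<beta> m) < 1"
    by (intro order_tendstoD(2)[of _ 0]) (auto simp: reg_param_def \<beta>_def)
  moreover have "\<forall>\<^sub>F m in sequentially.
      (q + 2 * norm w) * (\<beta> m - \<beta> (Suc m)) \<le> ((1 - \<theta>) * Phi L w q * \<mu>) * \<beta> m ^ 3"
    unfolding \<beta>_def using assms q Phi by (intro eventually_powr_decrement_le) auto
  ultimately have "\<forall>\<^sub>F m in sequentially. \<mu> * \<beta> m * (norm A + 2 * \<beta> m) < 1 \<and>
      (q + 2 * norm w) * (\<beta> m - \<beta> (Suc m)) \<le> (1 - \<theta>) * Phi L w q * \<mu> * \<beta> m ^ 3"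
    by (rule eventually_conj)
  then obtain k0 where k0: "\<And>m. k0 \<le> m \<Longrightarrow> \<mu> * \<beta> m * (norm A + 2 * \<beta> m) < 1 \<and>
      (q + 2 * norm w) * (\<beta> m - \<beta> (Suc m)) \<le> (1 - \<theta>) * Phi L w q * \<mu> * \<beta> m ^ 3"
    unfolding eventually_sequentially by blast
  show "\<exists>k0\<ge>1. \<forall>k\<ge>k0. \<forall>\<delta>\<ge>0. \<forall>(J\<delta> :: 'a \<Rightarrow> real) (J\<delta>' :: 'a \<Rightarrow> 'a) (x :: nat \<Rightarrow> 'a).
        (\<forall>z. GDERIV J\<delta> z :> J\<delta>' z) \<longrightarrow>
        (\<forall>z. norm (J\<delta>' z - J' z) \<le> \<delta> * (1 + norm (z - \<xi>))) \<longrightarrow>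
        (\<delta> = 0 \<longrightarrow> J\<delta> = J) \<longrightarrow>
        norm (x 1 - xstar) \<le> (q - 2 * norm w) * reg_param \<alpha>0 s k 1 \<longrightarrow>
        reg_gradient_iteration J\<delta>' \<xi> \<mu> (reg_param \<alpha>0 s k) x \<longrightarrow>
          (\<delta> = 0 \<longrightarrow>
            (\<forall>n\<ge>1. norm (x n - xstar) \<le> (q + 2 * norm w) * reg_param \<alpha>0 s k n)) \<and>
          (\<delta> > 0 \<longrightarrow>
            (\<forall>K2. K2 \<ge> sqrt (C9 (J'' xstar) w q (reg_param \<alpha>0 s k 1) / (\<theta> * Phi L w q)) \<longrightarrow>
              norm (x (stopping_index (reg_param \<alpha>0 s k) K2 \<delta>) - xstar)
                \<le> (q + 2 * norm w) * K2 * sqrt \<delta>))"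
  proof (intro exI[of _ "max 1 k0"] conjI allI impI)
    fix k \<delta> and J\<delta> :: "'a \<Rightarrow> real" and G :: "'a \<Rightarrow> 'a" and x :: "nat \<Rightarrow> 'a"
    assume k: "max 1 k0 \<le> k" and \<delta>: "0 \<le> \<delta>"
      and G: "\<forall>z. norm (G z - J' z) \<le> \<delta> * (1 + norm (z - \<xi>))"
      and x1: "norm (x 1 - xstar) \<le> (q - 2 * norm w) * reg_param \<alpha>0 s k 1"
      and x: "reg_gradient_iteration G \<xi> \<mu> (reg_param \<alpha>0 s k) x"
    define \<alpha> where "\<alpha> = reg_param \<alpha>0 s k"
    have \<alpha>_\<beta>: "\<alpha> n = \<beta> (n + k)" for n by (simp add: \<alpha>_def \<beta>_def reg_param_def)
    have \<alpha>_pos: "0 < \<alpha> n" if "1 \<le> n" for n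
      using that assms(12) by (simp add: \<alpha>_def reg_param_def)
    have \<alpha>_decr: "\<alpha> (Suc n) \<le> \<alpha> n" if "1 \<le> n" for n
      unfolding \<alpha>_def reg_param_def
      using that assms(12,13) by (intro mult_left_mono powr_mono2') auto
    have bound: "norm (x n - xstar) \<le> (q + 2 * norm w) * \<alpha> n"
      if "1 \<le> n" "n \<le> N" and
        noise: "\<And>n. 1 \<le> n \<Longrightarrow> n < N \<Longrightarrow> \<delta> * C9 A w q (\<alpha> 1) \<le> \<theta> * Phi L w q * (\<alpha> n)\<^sup>2" for n N
    proof (rule reg_gradient_iteration_bound[where G = G and J' = J' and \<delta> = \<delta> and L = L
          and \<theta> = \<theta> and \<xi> = \<xi> and N = N and A = A and \<mu> = \<mu>])
      fix m :: nat
      assume "1 \<le> m"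
      have "k0 \<le> m + k" using k by simp
      from k0[OF this] show "\<mu> * \<alpha> m * (norm A + 2 * \<alpha> m) \<le> 1"
        and "(q + 2 * norm w) * (\<alpha> m - \<alpha> (Suc m)) \<le> (1 - \<theta>) * Phi L w q * \<mu> * \<alpha> m ^ 3"
        by (simp_all add: \<alpha>_\<beta>)
    qed (use A J' G x x1 \<alpha>_pos \<alpha>_decr assms(5,7,11) q \<delta> that in \<open>auto simp: \<alpha>_def A_def\<close>)
    \<comment> \<open>With \<delta> = 0 the noise condition has left side 0, so the horizon can be
      \<open>n\<close> itself.\<close>
    show "norm (x n - xstar) \<le> (q + 2 * norm w) * reg_param \<alpha>0 s k n" if "\<delta> = 0" "1 \<le> n" for n
      unfolding \<alpha>_def[symmetric] using that(2)
      by (rule bound[of n n]) (use that(1) Phi assms(9) in auto)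
    fix K2 :: real
    assume \<delta>': "0 < \<delta>"
      and K2: "K2 \<ge> sqrt (C9 (J'' xstar) w q (reg_param \<alpha>0 s k 1) / (\<theta> * Phi L w q))"
    define c where "c = C9 A w q (\<alpha> 1)"
    define N where "N = stopping_index (reg_param \<alpha>0 s k) K2 \<delta>"
    have \<theta>\<Phi>: "0 < \<theta> * Phi L w q" using Phi assms(9) by simp
    \<comment> \<open>Positivity of \<open>c\<close> forces \<open>K2\<close> to be positive; the
      stopping threshold is then positive, and the minimum defining \<open>N\<close> is over a
      nonempty set.\<close>
    have "0 \<le> norm (A w)" "0 < (q + 2 * norm w) * \<alpha> 1"
      using q \<alpha>_pos[of 1] by (auto intro!: mult_pos_pos add_pos_nonneg)
    then have c: "0 < c" unfolding c_def C9_def by linarith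
    have K2': "sqrt (c / (\<theta> * Phi L w q)) \<le> K2" using K2 by (simp add: c_def A_def \<alpha>_def)
    moreover have "0 < sqrt (c / (\<theta> * Phi L w q))" using c \<theta>\<Phi> by simp
    ultimately have K2_pos: "0 < K2" by linarith
    have c_le: "c \<le> \<theta> * Phi L w q * K2\<^sup>2"
      using power_mono[OF K2', of 2] c \<theta>\<Phi> by (simp add: field_simps)
    have "\<forall>\<^sub>F n in sequentially. \<alpha> n < K2 * sqrt \<delta>"
      using K2_pos \<delta>' reg_param_tendsto_0[OF assms(13)]
      unfolding \<alpha>_def by (intro order_tendstoD(2)) auto
    then have "\<exists>n. 1 \<le> n \<and> \<alpha> n \<le> K2 * sqrt \<delta>"
      unfolding eventually_sequentially by (metis less_imp_le max.cobounded1 max.cobounded2)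
    then have N: "1 \<le> N \<and> \<alpha> N \<le> K2 * sqrt \<delta>"
      unfolding N_def stopping_index_def \<alpha>_def by (rule LeastI_ex)
    have "norm (x N - xstar) \<le> (q + 2 * norm w) * \<alpha> N"
    proof (rule bound[of N N])
      fix n
      assume n: "1 \<le> n" "n < N"
      \<comment> \<open>Minimality of \<open>N\<close> makes the parameter exceed the threshold
        before stopping; squaring and using \<open>c_le\<close> yields the noise condition.\<close>
      then have "K2 * sqrt \<delta> < \<alpha> n"
        unfolding N_def stopping_index_def \<alpha>_def using not_less_Least by (metis not_le_imp_less)
      then have "(K2 * sqrt \<delta>)\<^sup>2 \<le> (\<alpha> n)\<^sup>2"
        using K2_pos \<delta> by (intro power_mono) auto
      then have "\<theta> * Phi L w q * (K2\<^sup>2 * \<delta>) \<le> \<theta> * Phi L w q * (\<alpha> n)\<^sup>2"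
        using \<theta>\<Phi> \<delta> by (intro mult_left_mono) (auto simp: power_mult_distrib)
      moreover have "\<delta> * c \<le> \<delta> * (\<theta> * Phi L w q * K2\<^sup>2)"
        using c_le \<delta> by (rule mult_left_mono)
      ultimately show "\<delta> * C9 A w q (\<alpha> 1) \<le> \<theta> * Phi L w q * (\<alpha> n)\<^sup>2"
        by (simp add: c_def algebra_simps)
    qed (use N in auto)
    also have "\<dots> \<le> (q + 2 * norm w) * (K2 * sqrt \<delta>)"
      using N q by (intro mult_left_mono) auto
    finally show "norm (x (stopping_index (reg_param \<alpha>0 s k) K2 \<delta>) - xstar)
        \<le> (q + 2 * norm w) * K2 * sqrt \<delta>"
      by (simp add: N_def mult.assoc)
  qed simp
qed

end
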